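(* Let $0\le s\in\mathbb{R}$ and let the periodic Sobolev space $H^s(\mathbb{T}^N)$ be equipped with the norm $$\|u\|_{H^s(\mathbb{T}^N)}:=\Big(\sum_{k\in\mathbb{Z}^N}(1+4\pi^2|k|^2)^s|u_k|^2\Big)^{1/2}$$ and corresponding inner product $\langle u,v\rangle_{H^s(\mathbb{T}^N)}:=\sum_{k\in\mathbb{Z}^N}(1+4\pi^2|k|^2)^su_k\overline{v_k}$. Then for the embedding $E_s:H^s(\mathbb{T}^N)\to L_2(\mathbb{T}^N)$ and all $u\in L_2(\mathbb{T}^N)$ there holds $$(E_s^*u)(x)=\sum_{k\in\mathbb{Z}^N}(1+4\pi^2|k|^2)^{-s}u_ke_k(x),$$ where $e_k(x)=\exp(2\pi i\,k\cdot x)$ and $u_k=\langle u,e_k\rangle_{L_2((0,1)^N)}$ are the Fourier coefficients of $u$.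
   Context: $N\in\mathbb{N}$, $\mathbb{T}^N:=\mathbb{R}^N/\mathbb{Z}^N$ is the unit torus. $u_k,v_k$ denote the Fourier coefficients of $u,v$, $u_k=\int_{(0,1)^N}u(x)e^{-2\pi ik\cdot x}\,dx$. $H^s(\mathbb{T}^N):=\{u:\mathbb{T}^N\to\mathbb{C}\mid\|u\|_{H^s(\mathbb{T}^N)}<\infty\}$ with the norm in the claim, and $L_2(\mathbb{T}^N):=H^0(\mathbb{T}^N)$. The embedding is $E_su:=u$, and its adjoint $E_s^*:L_2(\mathbb{T}^N)\to H^s(\mathbb{T}^N)$ is defined by $\langle E_s^*u,v\rangle_{H^s(\mathbb{T}^N)}=\langle u,v\rangle_{L_2(\mathbb{T}^N)}$ for all $u\in L_2(\mathbb{T}^N)$, $v\in H^s(\mathbb{T}^N)$. *)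

theory Defs
  imports "HOL-Analysis.Analysis"
begin

definition lattice_vec :: "int ^ 'n \<Rightarrow> real ^ 'n::finite" where
  "lattice_vec k = (\<chi> i. real_of_int (k $ i))"

definition fourier_basis :: "int ^ 'n \<Rightarrow> real ^ 'n::finite \<Rightarrow> complex" where
  "fourier_basis k x = exp (2 * of_real pi * \<i> * of_real (lattice_vec k \<bullet> x))"

text \<open>
  Functions on the torus are identified with functions on \<open>\<real>\<^sup>N\<close> that are periodic with respect
  to the integer lattice. Fourier coefficients exist exactly for the (Lebesgue) integrable ones.
\<close>

definition torus_integrable :: "(real ^ 'n::finite \<Rightarrow> complex) \<Rightarrow> bool" where
  "torus_integrable f \<longleftrightarrow>
     (\<forall>m x. f (x + lattice_vec m) = f x) \<and> set_integrable lebesgue (box 0 One) f"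

definition torus_ae_eq ::
    "(real ^ 'n::finite \<Rightarrow> complex) \<Rightarrow> (real ^ 'n \<Rightarrow> complex) \<Rightarrow> bool" where
  "torus_ae_eq f g \<longleftrightarrow>
     torus_integrable f \<and> torus_integrable g \<and> (AE x in lebesgue. f x = g x)"

lemma torus_integrable_zero: "torus_integrable (\<lambda>_. 0)"
  by (simp add: torus_integrable_def set_integrable_def)

lemma torus_integrable_uminus: "torus_integrable f \<Longrightarrow> torus_integrable (\<lambda>x. - f x)"
  by (simp add: torus_integrable_def set_integrable_def)

lemma torus_integrable_add:
  "torus_integrable f \<Longrightarrow> torus_integrable g \<Longrightarrow> torus_integrable (\<lambda>x. f x + g x)"
  by (simp add: torus_integrable_def)

lemma torus_integrable_diff:
  "torus_integrable f \<Longrightarrow> torus_integrable g \<Longrightarrow> torus_integrable (\<lambda>x. f x - g x)"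
  by (simp add: torus_integrable_def)

lemma torus_integrable_mult:
  "torus_integrable f \<Longrightarrow> torus_integrable (\<lambda>x. c * f x)"
  by (simp add: torus_integrable_def)

lemma fourier_basis_periodic: "fourier_basis k (x + lattice_vec m) = fourier_basis k x"
proof -
  have "lattice_vec k \<bullet> lattice_vec m = real_of_int (\<Sum>i\<in>UNIV. k $ i * m $ i)"
    by (simp add: lattice_vec_def inner_vec_def)
  then obtain z :: int where z: "lattice_vec k \<bullet> lattice_vec m = of_int z" by blast
  have "exp (2 * of_real pi * \<i> * of_int z) = 1"
    by (subst exp_eq_1) (auto intro!: exI[of _ z])
  then show ?thesis
    by (simp add: fourier_basis_def inner_add_right z distrib_left exp_add)
qed

lemma continuous_fourier_basis: "continuous_on S (fourier_basis k)"
  unfolding fourier_basis_def by (intro continuous_intros)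

lemma torus_integrable_fourier_basis: "torus_integrable (fourier_basis k)"
proof -
  have "fourier_basis k absolutely_integrable_on cbox 0 One"
    by (intro absolutely_integrable_continuous continuous_fourier_basis)
  then have "fourier_basis k absolutely_integrable_on box 0 One"
    by (rule set_integrable_subset) (auto simp: box_subset_cbox)
  then show ?thesis
    by (simp add: torus_integrable_def fourier_basis_periodic)
qed

quotient_type 'n torus_L1 = "real ^ ('n::finite) \<Rightarrow> complex" / partial: torus_ae_eq
proof (rule part_equivpI)
  show "\<exists>f. torus_ae_eq f f"
    using torus_integrable_zero by (auto simp: torus_ae_eq_def)
  show "symp torus_ae_eq"
    by (rule sympI) (auto simp: torus_ae_eq_def elim: eventually_mono)
  show "transp torus_ae_eq"
    by (rule transpI) (auto simp: torus_ae_eq_def elim: eventually_elim2)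
qed

instantiation torus_L1 :: (finite) ab_group_add
begin

lift_definition zero_torus_L1 :: "'a torus_L1" is "\<lambda>_. 0"
  by (simp add: torus_ae_eq_def torus_integrable_zero)

lift_definition plus_torus_L1 :: "'a torus_L1 \<Rightarrow> 'a torus_L1 \<Rightarrow> 'a torus_L1"
  is "\<lambda>f g x. f x + g x"
  by (auto simp: torus_ae_eq_def torus_integrable_add elim: eventually_elim2)

lift_definition minus_torus_L1 :: "'a torus_L1 \<Rightarrow> 'a torus_L1 \<Rightarrow> 'a torus_L1"
  is "\<lambda>f g x. f x - g x"
  by (auto simp: torus_ae_eq_def torus_integrable_diff elim: eventually_elim2)

lift_definition uminus_torus_L1 :: "'a torus_L1 \<Rightarrow> 'a torus_L1" is "\<lambda>f x. - f x"
  by (auto simp: torus_ae_eq_def torus_integrable_uminus elim: eventually_mono)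

instance
  by standard
    (transfer; auto simp: torus_ae_eq_def torus_integrable_zero torus_integrable_add
       torus_integrable_diff torus_integrable_uminus algebra_simps)+

end

lift_definition torus_scale :: "complex \<Rightarrow> 'n::finite torus_L1 \<Rightarrow> 'n torus_L1"
  is "\<lambda>c f x. c * f x"
  by (auto simp: torus_ae_eq_def torus_integrable_mult elim: eventually_mono)

lift_definition torus_basis :: "int ^ 'n \<Rightarrow> 'n::finite torus_L1" is fourier_basis
  by (simp add: torus_ae_eq_def torus_integrable_fourier_basis)

lift_definition fourier_coeff :: "'n::finite torus_L1 \<Rightarrow> int ^ 'n \<Rightarrow> complex"
  is "\<lambda>f k. LINT x:box 0 One|lebesgue. f x * cnj (fourier_basis k x)"
proof
  fix f g :: "real ^ 'n \<Rightarrow> complex" and k :: "int ^ 'n"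
  assume fg: "torus_ae_eq f g"
  have meas: "(\<lambda>x. indicator (box 0 One) x *\<^sub>R (h x * cnj (fourier_basis k x)))
                \<in> borel_measurable lebesgue"
    if "torus_integrable h" for h :: "real ^ 'n \<Rightarrow> complex"
  proof -
    have "(\<lambda>x. cnj (fourier_basis k x)) \<in> borel_measurable lebesgue"
      by (intro measurable_completion)
         (simp add: borel_measurable_continuous_onI continuous_on_cnj continuous_fourier_basis)
    moreover have "(\<lambda>x. indicator (box 0 One) x *\<^sub>R h x) \<in> borel_measurable lebesgue"
      using that by (auto simp: torus_integrable_def set_integrable_def)
    ultimately have "(\<lambda>x. (indicator (box 0 One) x *\<^sub>R h x) * cnj (fourier_basis k x))
                       \<in> borel_measurable lebesgue"
      by (rule borel_measurable_times[rotated])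
    then show ?thesis by simp
  qed
  show "(LINT x:box 0 One|lebesgue. f x * cnj (fourier_basis k x)) =
        (LINT x:box 0 One|lebesgue. g x * cnj (fourier_basis k x))"
    unfolding set_lebesgue_integral_def
    using fg by (intro integral_cong_AE meas) (auto simp: torus_ae_eq_def elim: eventually_mono)
qed

lemma cnj_fourier_basis:
  "cnj (fourier_basis k x) = exp (- 2 * of_real pi * \<i> * of_real (lattice_vec k \<bullet> x))"
  by (simp add: fourier_basis_def exp_cnj)

definition sobolev_weight :: "int ^ 'n::finite \<Rightarrow> real" where
  "sobolev_weight k = 1 + 4 * pi\<^sup>2 * (norm (lattice_vec k))\<^sup>2"

definition sobolev_space :: "real \<Rightarrow> 'n::finite torus_L1 set" where
  "sobolev_space s =
     {u. (\<lambda>k. sobolev_weight k powr s * (cmod (fourier_coeff u k))\<^sup>2) summable_on UNIV}"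

text \<open>Meaningful only on \<open>sobolev_space s\<close>: a divergent infinite sum has value \<open>0\<close>.\<close>

definition sobolev_norm :: "real \<Rightarrow> 'n::finite torus_L1 \<Rightarrow> real" where
  "sobolev_norm s u =
     sqrt (\<Sum>\<^sub>\<infinity>k. sobolev_weight k powr s * (cmod (fourier_coeff u k))\<^sup>2)"

definition sobolev_inner ::
    "real \<Rightarrow> 'n::finite torus_L1 \<Rightarrow> 'n torus_L1 \<Rightarrow> complex" where
  "sobolev_inner s u v =
     (\<Sum>\<^sub>\<infinity>k. of_real (sobolev_weight k powr s) * fourier_coeff u k * cnj (fourier_coeff v k))"

abbreviation torus_L2 :: "'n::finite torus_L1 set" where
  "torus_L2 \<equiv> sobolev_space 0"

abbreviation torus_L2_inner :: "'n::finite torus_L1 \<Rightarrow> 'n torus_L1 \<Rightarrow> complex" where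
  "torus_L2_inner \<equiv> sobolev_inner 0"

text \<open>
  Elements of \<open>H\<^sup>s\<close> and of \<open>L\<^sub>2\<close> live in the same type, so the embedding is the identity
  there; its domain \<open>sobolev_space s\<close> enters through the adjoint.
\<close>

definition sobolev_embedding :: "real \<Rightarrow> 'n::finite torus_L1 \<Rightarrow> 'n torus_L1" where
  "sobolev_embedding s u = u"

definition sobolev_embedding_adjoint :: "real \<Rightarrow> 'n::finite torus_L1 \<Rightarrow> 'n torus_L1" where
  "sobolev_embedding_adjoint s u =
     (THE w. w \<in> sobolev_space s \<and>
        (\<forall>v\<in>sobolev_space s. sobolev_inner s w v = torus_L2_inner u (sobolev_embedding s v)))"

end

theory Submission
  imports Defs
begin

text \<open>
  Write \<open>W\<^sub>k = 1 + 4\<pi>\<^sup>2|k|\<^sup>2 \<ge> 1\<close>. If \<open>w\<close> has the Fourier coefficients \<open>W\<^sub>k\<^sup>-\<^sup>s u\<^sub>k\<close>, then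
  \<open>\<langle>w, v\<rangle>\<close> in \<open>H\<^sup>s\<close> and \<open>\<langle>u, v\<rangle>\<close> in \<open>L\<^sub>2\<close> are the same series term by term, so \<open>w\<close> satisfies the
  equation that defines the adjoint. Conversely, testing that equation with \<open>v = e\<^sub>k\<close> forces the
  \<open>k\<close>-th coefficient of any solution to be \<open>W\<^sub>k\<^sup>-\<^sup>s u\<^sub>k\<close>. Convergence of the Fourier series in \<open>H\<^sup>s\<close> is
  then the vanishing of the tails of a convergent series of nonnegative terms. Two classical
  facts on Fourier coefficients of integrable functions on the torus make this rigorous.

  \<^item> Existence of \<open>w\<close> (\<open>riesz_fischer\<close>): every square-summable family is the family of Fourier
    coefficients of an integrable function. The index set is cut into finite blocks whose square
    sums decay geometrically; on a probability space the \<open>L\<^sub>1\<close> norm is bounded by the \<open>L\<^sub>2\<close> norm, so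
    the corresponding series of trigonometric polynomials converges absolutely in \<open>L\<^sub>1\<close>, which
    suffices to compute the coefficients of its sum.

  \<^item> Uniqueness of \<open>w\<close> (\<open>fourier_coeff_eqI\<close>): an integrable function \<open>f\<close> with vanishing Fourier
    coefficients is zero almost everywhere. Embed the torus into \<open>\<complex>\<^sup>N\<close> by
    \<open>x \<mapsto> (exp (2\<pi>i x\<^sub>j))\<^sub>j\<close>. Polynomials in the real and imaginary parts of the coordinates of
    \<open>\<complex>\<^sup>N\<close> pull back to trigonometric polynomials, so by the Stone--Weierstrass theorem \<open>f\<close> is orthogonal to all pullbacks of continuous functions, hence
    has integral zero over every compact subset \<open>K\<close> of the open unit cell. Compact
    sets on which the real or the imaginary part of \<open>f\<close> is everywhere positive, or everywhere
    negative, are therefore null sets. A measurable set is up to a null set a countable union of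
    compact sets, so both parts of \<open>f\<close> vanish almost everywhere.
\<close>

section \<open>Exponentials and integration over the unit cell\<close>

lemma lattice_vec_0 [simp]: "lattice_vec 0 = 0"
  by (simp add: lattice_vec_def vec_eq_iff)

lemma lattice_vec_add: "lattice_vec (k + l) = lattice_vec k + lattice_vec l"
  by (simp add: lattice_vec_def vec_eq_iff)

lemma lattice_vec_uminus: "lattice_vec (- k) = - lattice_vec k"
  by (simp add: lattice_vec_def vec_eq_iff)

lemma fourier_basis_0 [simp]: "fourier_basis 0 x = 1"
  by (simp add: fourier_basis_def)

lemma fourier_basis_mult: "fourier_basis k x * fourier_basis l x = fourier_basis (k + l) x"
  by (simp add: fourier_basis_def lattice_vec_add inner_add_left distrib_left exp_add)

lemma cnj_fourier_basis_uminus: "cnj (fourier_basis k x) = fourier_basis (- k) x"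
  by (simp add: fourier_basis_def lattice_vec_uminus exp_cnj)

lemma norm_fourier_basis [simp]: "norm (fourier_basis k x) = 1"
  by (simp add: fourier_basis_def norm_exp_eq_Re)

text \<open>Lebesgue measure on the open unit cell, a probability measure.\<close>

abbreviation cell_measure :: "(real ^ 'n::finite) measure"
  where "cell_measure \<equiv> lebesgue_on (box 0 One)"

lemma set_integrable_cell_iff:
  fixes f :: "real ^ 'n::finite \<Rightarrow> 'b::{banach, second_countable_topology}"
  shows "set_integrable lebesgue (box 0 One) f \<longleftrightarrow> integrable cell_measure f"
  by (simp add: set_integrable_def integrable_restrict_space)

lemma set_integral_cell_eq:
  fixes f :: "real ^ 'n::finite \<Rightarrow> 'b::{banach, second_countable_topology}"
  shows "(LINT x:box 0 One|lebesgue. f x) = (LINT x|cell_measure. f x)"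
  by (simp add: set_lebesgue_integral_def integral_restrict_space)

lemma measure_cell: "emeasure (lebesgue :: (real ^ 'n::finite) measure) (box 0 One) = 1"
  by (simp add: emeasure_lborel_box inner_diff_left)

lemma emeasure_cell_space: "emeasure cell_measure (box 0 (One :: real ^ 'n::finite)) = 1"
  using measure_cell by (subst emeasure_restrict_space) auto

lemma measurable_cell_continuous:
  fixes g :: "real ^ 'n::finite \<Rightarrow> 'b::{real_normed_vector, second_countable_topology}"
  assumes "continuous_on UNIV g"
  shows "g \<in> borel_measurable cell_measure"
  by (intro measurable_restrict_space1 measurable_completion)
     (simp add: assms borel_measurable_continuous_onI)

lemma integrable_cell_mult_bounded:
  fixes f g :: "real ^ 'n::finite \<Rightarrow> complex"
  assumes f: "integrable cell_measure f" and g: "continuous_on UNIV g"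
    and B: "\<And>x. norm (g x) \<le> B"
  shows "integrable cell_measure (\<lambda>x. f x * g x)"
proof (rule Bochner_Integration.integrable_bound)
  show "integrable cell_measure (\<lambda>x. B * norm (f x))"
    using f by simp
  show "(\<lambda>x. f x * g x) \<in> borel_measurable cell_measure"
    using f measurable_cell_continuous[OF g] by (intro borel_measurable_times) auto
  have "norm (f x * g x) \<le> norm (B * norm (f x))" for x
  proof -
    have "norm (f x * g x) \<le> B * norm (f x)"
      using mult_right_mono[OF B[of x], of "norm (f x)"] by (simp add: norm_mult mult.commute)
    then show ?thesis by simp
  qed
  then show "AE x in cell_measure. norm (f x * g x) \<le> norm (B * norm (f x))" by simp
qed

lemma integrable_cell_fourier_basis: "integrable cell_measure (fourier_basis k)"
  using torus_integrable_fourier_basis[of k]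
  by (simp add: torus_integrable_def set_integrable_cell_iff)

lemma integrable_cell_mult_fourier_basis:
  assumes "integrable cell_measure f"
  shows "integrable cell_measure (\<lambda>x. f x * fourier_basis k x)"
  by (rule integrable_cell_mult_bounded[OF assms continuous_fourier_basis, of _ 1]) simp

section \<open>Orthonormality of the exponentials\<close>

lemma integral_exp_unit_interval:
  assumes "n \<noteq> 0"
  shows "(LINT t|lborel. indicator {0<..<1} t *\<^sub>R exp (2 * of_real pi * \<i> * of_real (of_int n * t))) = 0"
proof -
  let ?a = "2 * of_real pi * \<i> * of_int n :: complex"
  let ?f = "\<lambda>t::real. exp (?a * of_real t)"
  have a: "?a \<noteq> 0" using assms by simp
  have "(?f has_integral (exp (?a * of_real 1) / ?a - exp (?a * of_real 0) / ?a)) {0..1}"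
  proof (rule fundamental_theorem_of_calculus)
    fix x :: real assume "x \<in> {0..1}"
    have "((\<lambda>z. exp (?a * z) / ?a) has_field_derivative exp (?a * of_real x)) (at (of_real x))"
      using assms by (auto intro!: derivative_eq_intros)
    from has_vector_derivative_real_field[OF this]
    show "((\<lambda>x. exp (?a * of_real x) / ?a) has_vector_derivative exp (?a * of_real x)) (at x within {0..1})"
      by (simp add: has_vector_derivative_at_within)
  qed simp
  moreover have "exp ?a = 1"
    by (subst exp_eq_1) (auto intro!: exI[of _ n])
  ultimately have 0: "(?f has_integral 0) {0..1}" by simp
  have "set_integrable lborel {0..1} ?f"
    by (rule borel_integrable_atLeastAtMost') (intro continuous_intros)
  then have int: "set_integrable lborel {0<..<1} ?f"
    by (rule set_integrable_subset) auto
  have "(LINT t:{0<..<1}|lborel. ?f t) = integral {0<..<1} ?f"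
    by (rule set_borel_integral_eq_integral[OF int])
  also have "\<dots> = 0"
    using 0 integral_open_interval_real[of 0 1 ?f] by (simp add: integral_unique)
  finally show ?thesis
    by (simp add: set_lebesgue_integral_def mult.assoc)
qed

lemma integral_cell_fourier_basis:
  fixes k :: "int ^ 'n::finite"
  shows
  "(LINT x|cell_measure. fourier_basis k x) = (if k = 0 then 1 else 0)"
proof (cases "k = 0")
  case True
  then show ?thesis
    using emeasure_cell_space[where 'n='n] by (simp add: measure_def space_restrict_space)
next
  case False
  then obtain j where j: "k $ j \<noteq> 0" by (auto simp: vec_eq_iff)
  \<comment> \<open>Lebesgue measure is a product of one-dimensional measures and the integrand is a product, with
      a factor of integral zero in the direction \<open>j\<close>.\<close>
  interpret product_sigma_finite "\<lambda>_ :: real ^ 'n. lborel :: real measure" ..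
  define h where "h b t = indicator {0<..<1} t *\<^sub>R
      exp (2 * of_real pi * \<i> * of_real ((lattice_vec k \<bullet> b) * t))" for b :: "real ^ 'n" and t :: real
  have h_int: "integrable lborel (h b)" for b
  proof -
    have "set_integrable lborel {0..1} (\<lambda>t. exp (2 * of_real pi * \<i> * of_real ((lattice_vec k \<bullet> b) * t)))"
      by (rule borel_integrable_atLeastAtMost') (intro continuous_intros)
    then have "set_integrable lborel {0<..<1} (\<lambda>t. exp (2 * of_real pi * \<i> * of_real ((lattice_vec k \<bullet> b) * t)))"
      by (rule set_integrable_subset) auto
    then show ?thesis by (simp add: set_integrable_def h_def[abs_def])
  qed
  let ?g = "\<lambda>x. indicator (box 0 One) x *\<^sub>R fourier_basis k x"
  have meas: "?g \<in> borel_measurable borel"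
    using borel_measurable_continuous_onI[OF continuous_fourier_basis[of UNIV k]] by measurable
  have prod: "?g (\<Sum>b\<in>Basis. f b *\<^sub>R b) = (\<Prod>b\<in>Basis. h b (f b))" for f :: "real ^ 'n \<Rightarrow> real"
  proof -
    have "indicator (box 0 One) (\<Sum>b\<in>Basis. f b *\<^sub>R b) = (\<Prod>b\<in>Basis. indicator {0<..<1} (f b) :: real)"
    proof -
      have "(\<Prod>b\<in>Basis. indicator {0<..<1} (f b) :: real) = (if \<forall>b\<in>Basis. f b \<in> {0<..<1} then 1 else 0)"
        by (auto simp: indicator_def intro!: prod.neutral)
      then show ?thesis
        by (simp add: indicator_def mem_box)
    qed
    moreover have "fourier_basis k (\<Sum>b\<in>Basis. f b *\<^sub>R b) =
        (\<Prod>b\<in>Basis. exp (2 * of_real pi * \<i> * of_real ((lattice_vec k \<bullet> b) * f b)))"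
      by (simp add: fourier_basis_def inner_sum_right sum_distrib_left exp_sum mult_ac)
    ultimately show ?thesis
      by (simp only: h_def scaleR_conv_of_real of_real_prod prod.distrib)
  qed
  have "(LINT x|cell_measure. fourier_basis k x) = (LINT x|lebesgue. ?g x)"
    by (simp add: integral_restrict_space)
  also have "\<dots> = (LINT x|lborel. ?g x)"
    using meas by (intro integral_completion) simp
  also have "\<dots> = (LINT f|(\<Pi>\<^sub>M b\<in>Basis. lborel). ?g (\<Sum>b\<in>Basis. f b *\<^sub>R b))"
    using meas by (subst lborel_eq, subst integral_distr) auto
  also have "\<dots> = (LINT f|(\<Pi>\<^sub>M b\<in>Basis. lborel). (\<Prod>b\<in>Basis. h b (f b)))"
    by (simp only: prod)
  also have "\<dots> = (\<Prod>b\<in>Basis. LINT t|lborel. h b t)"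
    by (rule product_integral_prod) (auto intro: h_int)
  also have "\<dots> = 0"
  proof (rule prod_zero)
    have "lattice_vec k \<bullet> axis j 1 = of_int (k $ j)"
      by (simp add: lattice_vec_def inner_axis)
    then have "(LINT t|lborel. h (axis j 1) t) = 0"
      using integral_exp_unit_interval[OF j] by (simp add: h_def)
    then show "\<exists>b\<in>Basis. (LINT t|lborel. h b t) = 0"
      by (intro bexI[of _ "axis j 1"]) (auto simp: axis_in_Basis_iff)
  qed simp
  finally show ?thesis using False by simp
qed

lemma fourier_basis_orthonormal:
  "(LINT x|cell_measure. fourier_basis k x * cnj (fourier_basis l x)) = (if k = l then 1 else 0)"
  by (simp add: cnj_fourier_basis_uminus fourier_basis_mult integral_cell_fourier_basis)

lemma integral_norm_square_trig_poly:
  assumes "finite B"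
  shows "(LINT x|cell_measure. (norm (\<Sum>k\<in>B. c k * fourier_basis k x))\<^sup>2) = (\<Sum>k\<in>B. (norm (c k))\<^sup>2)"
proof -
  let ?D = "\<lambda>x. \<Sum>k\<in>B. c k * fourier_basis k x"
  have eq: "complex_of_real ((norm (?D x))\<^sup>2) =
     (\<Sum>k\<in>B. \<Sum>l\<in>B. (c k * cnj (c l)) * (fourier_basis k x * cnj (fourier_basis l x)))" for x
    by (simp only: complex_norm_square cnj_sum sum_product complex_cnj_mult) (simp add: mult_ac)
  have int: "integrable cell_measure (\<lambda>x. (c k * cnj (c l)) * (fourier_basis k x * cnj (fourier_basis l x)))" for k l
    by (simp add: cnj_fourier_basis_uminus fourier_basis_mult integrable_cell_fourier_basis)
  have "complex_of_real (LINT x|cell_measure. (norm (?D x))\<^sup>2) = (LINT x|cell_measure. complex_of_real ((norm (?D x))\<^sup>2))"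
    by (rule integral_complex_of_real[symmetric])
  also have "\<dots> = (\<Sum>k\<in>B. \<Sum>l\<in>B. (c k * cnj (c l)) * (if k = l then 1 else 0))"
    by (simp only: eq Bochner_Integration.integral_sum Bochner_Integration.integrable_sum int
         integral_mult_right_zero fourier_basis_orthonormal)
  also have "\<dots> = (\<Sum>k\<in>B. c k * cnj (c k))"
    using assms by (intro sum.cong refl) (simp add: if_distrib[of "\<lambda>y. _ * y"] cong: if_cong)
  also have "\<dots> = of_real (\<Sum>k\<in>B. (norm (c k))\<^sup>2)"
    by (simp only: of_real_sum complex_norm_square)
  finally show ?thesis by (simp only: of_real_eq_iff)
qed

text \<open>
  The bound of the \<open>L\<^sub>1\<close> norm by the \<open>L\<^sub>2\<close> norm on a probability space. Integrating
  \<open>|D| \<le> t/2 + |D|\<^sup>2/(2t)\<close> replaces the Cauchy--Schwarz inequality.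
\<close>

lemma integral_norm_trig_poly_le:
  fixes c :: "int ^ 'n::finite \<Rightarrow> complex"
  assumes "finite B" "t > 0" "(\<Sum>k\<in>B. (norm (c k))\<^sup>2) \<le> t\<^sup>2"
  shows "(LINT x|cell_measure. norm (\<Sum>k\<in>B. c k * fourier_basis k x)) \<le> t"
proof -
  let ?D = "\<lambda>x. \<Sum>k\<in>B. c k * fourier_basis k x"
  have contD: "continuous_on UNIV ?D"
    by (intro continuous_intros continuous_fourier_basis)
  have fin: "finite_measure (cell_measure :: (real ^ 'n) measure)"
    by (rule finite_measureI) (use emeasure_cell_space[where 'n='n] in \<open>simp add: space_restrict_space\<close>)
  then interpret finite_measure "cell_measure :: (real ^ 'n) measure" .
  have "norm (?D x) \<le> (\<Sum>k\<in>B. norm (c k))" for x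
    by (rule order_trans[OF norm_sum]) (simp add: norm_mult)
  then have b: "norm ((norm (?D x))\<^sup>2) \<le> (\<Sum>k\<in>B. norm (c k))\<^sup>2" for x
    by (simp add: power_mono)
  have int2: "integrable cell_measure (\<lambda>x. (norm (?D x))\<^sup>2)"
    by (rule integrable_const_bound[where B = "(\<Sum>k\<in>B. norm (c k))\<^sup>2"])
       (use b in \<open>auto intro!: measurable_cell_continuous continuous_intros contD\<close>)
  have pt: "norm (?D x) \<le> t / 2 + (norm (?D x))\<^sup>2 / (2 * t)" for x
  proof -
    have "0 \<le> (t - norm (?D x))\<^sup>2" by simp
    then show ?thesis using \<open>t > 0\<close>
      by (simp add: field_simps power2_eq_square)
  qed
  have intD: "integrable cell_measure (\<lambda>x. norm (?D x))"
    by (intro integrable_norm Bochner_Integration.integrable_sum integrable_mult_right integrable_cell_fourier_basis)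
  have "(LINT x|cell_measure. norm (?D x)) \<le> (LINT x|cell_measure. t / 2 + (norm (?D x))\<^sup>2 / (2 * t))"
    using int2 by (intro integral_mono intD pt) auto
  also have "\<dots> = t / 2 + (\<Sum>k\<in>B. (norm (c k))\<^sup>2) / (2 * t)"
    using int2 integral_norm_square_trig_poly[OF assms(1), of c] emeasure_cell_space[where 'n='n]
    by (simp add: measure_def space_restrict_space)
  also have "\<dots> \<le> t / 2 + t\<^sup>2 / (2 * t)"
    using assms by (intro add_left_mono divide_right_mono) auto
  also have "\<dots> = t" using assms by (simp add: power2_eq_square)
  finally show ?thesis .
qed

section \<open>The Riesz--Fischer theorem\<close>

lemma AE_summable_norm:
  fixes f :: "nat \<Rightarrow> 'a \<Rightarrow> 'b::{banach, second_countable_topology}"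
  assumes f: "\<And>i. integrable M (f i)" and s: "summable (\<lambda>i. LINT x|M. norm (f i x))"
  shows "AE x in M. summable (\<lambda>i. norm (f i x))"
proof -
  have meas: "(\<lambda>x. ennreal (norm (f i x))) \<in> borel_measurable M" for i
    using borel_measurable_integrable[OF f[of i]] by measurable
  have "(\<integral>\<^sup>+x. (\<Sum>i. ennreal (norm (f i x))) \<partial>M) = (\<Sum>i. \<integral>\<^sup>+x. ennreal (norm (f i x)) \<partial>M)"
    by (rule nn_integral_suminf[OF meas])
  also have "\<dots> = (\<Sum>i. ennreal (LINT x|M. norm (f i x)))"
    by (simp add: nn_integral_eq_integral[OF integrable_norm[OF f]])
  also have "\<dots> \<noteq> \<infinity>"
    unfolding infinity_ennreal_def by (rule ennreal_suminf_neq_top[OF s]) simp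
  finally have "AE x in M. (\<Sum>i. ennreal (norm (f i x))) \<noteq> \<infinity>"
    by (intro nn_integral_PInf_AE borel_measurable_suminf_order meas)
  then show ?thesis
    by eventually_elim (simp add: summable_suminf_not_top)
qed

lemma infsum_tail_small:
  fixes g :: "'a \<Rightarrow> real"
  assumes g: "g summable_on UNIV" and nonneg: "\<And>k. 0 \<le> g k" and "e > 0"
  shows "\<exists>F. finite F \<and> (\<forall>G. finite G \<and> G \<inter> F = {} \<longrightarrow> sum g G \<le> e)"
proof -
  have "((\<lambda>F. sum g F) \<longlongrightarrow> infsum g UNIV) (finite_subsets_at_top UNIV)"
    by (rule infsum_tendsto[OF g])
  then have "eventually (\<lambda>F. dist (sum g F) (infsum g UNIV) < e) (finite_subsets_at_top UNIV)"
    using \<open>e > 0\<close> by (rule tendstoD)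
  then obtain F where F: "finite F" "dist (sum g F) (infsum g UNIV) < e"
    unfolding eventually_finite_subsets_at_top by blast
  have "sum g G \<le> e" if G: "finite G" "G \<inter> F = {}" for G
  proof -
    have "sum g (G \<union> F) \<le> infsum g UNIV"
      using F G nonneg by (intro finite_sum_le_infsum g) auto
    moreover have "sum g (G \<union> F) = sum g G + sum g F"
      using F G by (intro sum.union_disjoint) auto
    ultimately show ?thesis using F by (simp add: dist_real_def)
  qed
  with F show ?thesis by blast
qed

lemma integral_trig_poly_coeff:
  assumes "finite B"
  shows "(LINT x|cell_measure. (\<Sum>l\<in>B. c l * fourier_basis l x) * cnj (fourier_basis k x)) =
         (if k \<in> B then c k else 0)"
proof -
  have int: "integrable cell_measure (\<lambda>x. c l * (fourier_basis l x * cnj (fourier_basis k x)))" for l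
    by (simp add: cnj_fourier_basis_uminus fourier_basis_mult integrable_cell_fourier_basis)
  have "(LINT x|cell_measure. (\<Sum>l\<in>B. c l * fourier_basis l x) * cnj (fourier_basis k x)) =
        (LINT x|cell_measure. (\<Sum>l\<in>B. c l * (fourier_basis l x * cnj (fourier_basis k x))))"
    by (simp add: sum_distrib_right mult.assoc)
  also have "\<dots> = (\<Sum>l\<in>B. c l * (if l = k then 1 else 0))"
    by (simp only: Bochner_Integration.integral_sum int integral_mult_right_zero fourier_basis_orthonormal)
  also have "\<dots> = (if k \<in> B then c k else 0)"
    using assms by (simp add: if_distrib[of "\<lambda>y. _ * y"] cong: if_cong)
  finally show ?thesis .
qed

lemma riesz_fischer_function:
  fixes c :: "int ^ 'n::finite \<Rightarrow> complex"
  assumes c: "(\<lambda>k. (norm (c k))\<^sup>2) summable_on UNIV"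
  obtains W :: "real ^ 'n \<Rightarrow> complex" where "torus_integrable W"
    "\<And>k. (LINT x|cell_measure. W x * cnj (fourier_basis k x)) = c k"
proof -
  let ?g = "\<lambda>k. (norm (c k))\<^sup>2"
  define S where "S = infsum ?g UNIV"
  have S0: "0 \<le> S" unfolding S_def by (rule infsum_nonneg) simp
  have "\<exists>F. finite F \<and> (\<forall>G. finite G \<and> G \<inter> F = {} \<longrightarrow> sum ?g G \<le> (1/4)^j)" for j :: nat
    by (rule infsum_tail_small[OF c]) auto
  \<comment> \<open>Outside \<open>F j\<close> the square sums are at most \<open>4\<^sup>-\<^sup>j\<close>. The blocks \<open>B j\<close> are disjoint, cover all \<open>F i\<close>,
      and \<open>B (j + 1)\<close> avoids \<open>F j\<close>. The factor \<open>1 + S\<close> in \<open>t j\<close> takes care of the first block.\<close>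
  then obtain F where finF: "\<And>j. finite (F j)"
    and F: "\<And>j G. finite G \<Longrightarrow> G \<inter> F j = {} \<Longrightarrow> sum ?g G \<le> (1/4)^j"
    by metis
  define A where "A j = (\<Union>i<j. F i)" for j
  define B where "B j = A (Suc j) - A j" for j
  have finB: "finite (B j)" for j by (simp add: B_def A_def finF)
  define t :: "nat \<Rightarrow> real" where "t j = 2 * (1 + S) * (1/2)^j" for j
  have t0: "t j > 0" for j using S0 by (simp add: t_def)
  have t2: "(t j)\<^sup>2 = 4 * (1 + S)\<^sup>2 * (1/4)^j" for j
  proof -
    have "((1/2 :: real)^j)\<^sup>2 = ((1/2)\<^sup>2)^j"
      by (metis power_mult mult.commute)
    also have "(1/2 :: real)\<^sup>2 = 1/4" by (simp add: power2_eq_square)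
    finally have "((1/2 :: real)^j)\<^sup>2 = (1/4)^j" .
    moreover have "(2 :: real)\<^sup>2 = 4" by simp
    ultimately show ?thesis by (simp only: t_def power_mult_distrib)
  qed
  have "1 + S \<le> (1 + S)\<^sup>2"
    using S0 by (intro self_le_power) auto
  then have S1: "1 \<le> (1 + S)\<^sup>2" "S \<le> (1 + S)\<^sup>2"
    using S0 by linarith+
  have Bt: "sum ?g (B j) \<le> (t j)\<^sup>2" for j
  proof (cases j)
    case 0
    have "sum ?g (B 0) \<le> S"
      unfolding S_def by (rule finite_sum_le_infsum) (auto simp: c finB)
    then show ?thesis using S1 S0 0 by (simp add: t2)
  next
    case (Suc i)
    have "B j \<inter> F i = {}" by (auto simp: B_def A_def Suc)
    then have "sum ?g (B j) \<le> (1/4)^i" by (rule F[OF finB])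
    also have "\<dots> \<le> (1 + S)\<^sup>2 * (1/4)^i"
      using S1 mult_right_mono[of 1 "(1 + S)\<^sup>2" "(1/4::real)^i"] by simp
    also have "\<dots> = (t j)\<^sup>2" by (simp add: t2 Suc)
    finally show ?thesis .
  qed
  define D where "D j x = (\<Sum>k\<in>B j. c k * fourier_basis k x)" for j and x :: "real ^ 'n"
  have contD: "continuous_on UNIV (D j)" for j
    unfolding D_def by (intro continuous_intros continuous_fourier_basis)
  have intD: "integrable cell_measure (D j)" for j
    unfolding D_def
    by (intro Bochner_Integration.integrable_sum integrable_mult_right integrable_cell_fourier_basis)
  have D_le: "(LINT x|cell_measure. norm (D j x)) \<le> t j" for j
    unfolding D_def by (rule integral_norm_trig_poly_le[OF finB t0 Bt])
  have "summable t"
    unfolding t_def by (intro summable_mult summable_geometric) simp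
  then have sumD: "summable (\<lambda>j. LINT x|cell_measure. norm (D j x))"
    by (rule summable_comparison_test'[where N = 0]) (use D_le in \<open>simp add: integral_nonneg_AE\<close>)
  have AE: "AE x in cell_measure. summable (\<lambda>j. norm (D j x))"
    by (rule AE_summable_norm[OF intD sumD])
  define W where "W x = (\<Sum>j. D j x)" for x
  have intW: "integrable cell_measure W"
    unfolding W_def by (rule integrable_suminf[OF intD AE sumD])
  have per: "W (x + lattice_vec m) = W x" for x m
    by (simp add: W_def D_def fourier_basis_periodic)
  have coeff: "(LINT x|cell_measure. W x * cnj (fourier_basis k x)) = c k" for k
  proof -
    let ?f = "\<lambda>j x. D j x * cnj (fourier_basis k x)"
    have int: "integrable cell_measure (?f j)" for j
      unfolding cnj_fourier_basis_uminus by (rule integrable_cell_mult_fourier_basis[OF intD])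
    have n: "norm (?f j x) = norm (D j x)" for j x by (simp add: norm_mult)
    have "(\<lambda>j. LINT x|cell_measure. ?f j x) sums (LINT x|cell_measure. (\<Sum>j. ?f j x))"
      by (rule sums_integral) (simp_all only: int n AE sumD)
    moreover have "(LINT x|cell_measure. (\<Sum>j. ?f j x)) = (LINT x|cell_measure. W x * cnj (fourier_basis k x))"
    proof (rule integral_cong_AE)
      show "(\<lambda>x. \<Sum>j. ?f j x) \<in> borel_measurable cell_measure"
        using int by (intro borel_measurable_suminf) auto
      show "(\<lambda>x. W x * cnj (fourier_basis k x)) \<in> borel_measurable cell_measure"
        using integrable_cell_mult_fourier_basis[OF intW, of "- k"]
        unfolding cnj_fourier_basis_uminus by auto
      show "AE x in cell_measure. (\<Sum>j. ?f j x) = W x * cnj (fourier_basis k x)"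
        using AE unfolding W_def
        by eventually_elim (rule suminf_mult2[symmetric], rule summable_norm_cancel)
    qed
    moreover have "(LINT x|cell_measure. ?f j x) = (if k \<in> B j then c k else 0)" for j
      unfolding D_def by (rule integral_trig_poly_coeff[OF finB])
    ultimately have "(\<lambda>j. if k \<in> B j then c k else 0) sums
        (LINT x|cell_measure. W x * cnj (fourier_basis k x))"
      by (simp only:)
    moreover have "(\<lambda>j. if k \<in> B j then c k else 0) sums c k"
    proof (cases "\<exists>j. k \<in> F j")
      case True
      define j where "j = (LEAST j. k \<in> F j)"
      have "k \<in> B i \<longleftrightarrow> i = j" for i
      proof -
        have "k \<in> F j" unfolding j_def using True by (rule LeastI_ex)
        moreover have "k \<notin> F i" if "i < j" for i
          using that not_less_Least[of i "\<lambda>j. k \<in> F j"] by (auto simp: j_def)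
        moreover have "k \<in> B i \<longleftrightarrow> k \<in> F i \<and> (\<forall>l<i. k \<notin> F l)"
          by (auto simp: B_def A_def less_Suc_eq)
        ultimately show ?thesis using linorder_neqE_nat by blast
      qed
      then have "(\<lambda>i. if k \<in> B i then c k else 0) = (\<lambda>i. if i = j then c k else 0)"
        by presburger
      then show ?thesis using sums_single[of j "\<lambda>_. c k"] by presburger
    next
      case False
      \<comment> \<open>Indices outside all blocks carry a zero coefficient.\<close>
      have le: "?g k \<le> (1/4)^j" for j
      proof -
        have "{k} \<inter> F j = {}" using False by blast
        then show ?thesis using F[of "{k}" j] by simp
      qed
      have "(\<lambda>j. (1/4 :: real)^j) \<longlonglongrightarrow> 0" by (rule LIMSEQ_power_zero) simp
      then have "?g k \<le> 0"
        by (rule LIMSEQ_le_const) (use le in blast)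
      then have "c k = 0" by simp
      then show ?thesis by (simp only: if_cancel sums_zero)
    qed
    ultimately show ?thesis by (rule sums_unique2)
  qed
  show thesis
  proof (rule that)
    show "torus_integrable W"
      unfolding torus_integrable_def set_integrable_cell_iff using per intW by blast
  qed (rule coeff)
qed

section \<open>Integrable functions with vanishing Fourier coefficients\<close>

text \<open>
  Integrable functions on the unit cell all of whose Fourier coefficients vanish. The exponentials
  are not conjugated, which only replaces \<open>k\<close> by \<open>- k\<close>.
\<close>

definition null_coeffs :: "(real ^ 'n::finite \<Rightarrow> complex) \<Rightarrow> bool" where
  "null_coeffs f \<longleftrightarrow> integrable cell_measure f \<and>
     (\<forall>k. (LINT x|cell_measure. f x * fourier_basis k x) = 0)"

lemma null_coeffs_mult_basis:
  assumes "null_coeffs f" shows "null_coeffs (\<lambda>x. f x * fourier_basis k x)"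
  using assms
  by (simp add: null_coeffs_def integrable_cell_mult_fourier_basis mult.assoc fourier_basis_mult)

lemma null_coeffs_add:
  assumes "null_coeffs f" "null_coeffs g" shows "null_coeffs (\<lambda>x. f x + g x)"
  using assms
  by (simp add: null_coeffs_def integrable_cell_mult_fourier_basis distrib_right)

lemma null_coeffs_cmult:
  assumes "null_coeffs f" shows "null_coeffs (\<lambda>x. c * f x)"
  using assms by (simp add: null_coeffs_def mult.assoc)

lemma null_coeffs_sum:
  assumes "finite I" "\<And>i. i \<in> I \<Longrightarrow> null_coeffs (f i)"
  shows "null_coeffs (\<lambda>x. \<Sum>i\<in>I. f i x)"
  using assms
proof (induction I rule: finite_induct)
  case empty
  then show ?case by (simp add: null_coeffs_def)
next
  case (insert i I)
  then show ?case by (simp add: null_coeffs_add)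
qed

lemma compact_imp_sets_lebesgue: "compact K \<Longrightarrow> K \<in> sets lebesgue"
  by (intro sets_completionI_sets) (simp add: borel_compact)

lemma sum_Basis_nth [simp]: "(\<Sum>b\<in>(Basis :: (real ^ 'n::finite) set). b $ j) = 1"
proof -
  have "(\<Sum>b\<in>(Basis :: (real ^ 'n) set). b $ j) =
      (\<Sum>b\<in>(Basis :: (real ^ 'n) set). if b = axis j 1 then 1 else 0)"
    by (rule sum.cong) (simp_all add: cart_eq_inner_axis inner_Basis axis_in_Basis_iff)
  also have "\<dots> = 1" by (simp add: axis_in_Basis_iff)
  finally show ?thesis .
qed

text \<open>
  The embedding of the torus into \<open>\<complex>\<^sup>N\<close>; its \<open>j\<close>-th component is \<open>exp (2\<pi>i x\<^sub>j)\<close>.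
\<close>

definition torus_point :: "real ^ 'n::finite \<Rightarrow> complex ^ 'n" where
  "torus_point x = (\<chi> j. fourier_basis (axis j 1) x)"

lemma continuous_torus_point: "continuous_on S torus_point"
  unfolding torus_point_def by (intro continuous_on_vec_lambda continuous_fourier_basis)

lemma torus_point_inj:
  fixes x y :: "real ^ 'n::finite"
  assumes eq: "torus_point x = torus_point y" and x: "x \<in> box 0 One" and y: "y \<in> box 0 One"
  shows "x = y"
proof (subst vec_eq_iff, intro allI)
  fix j
  have comp: "lattice_vec (axis j 1) \<bullet> z = z $ j" for z :: "real ^ 'n"
  proof -
    have "lattice_vec (axis j 1) = (axis j 1 :: real ^ 'n)"
      by (simp add: lattice_vec_def vec_eq_iff axis_def)
    then show ?thesis by (simp add: inner_axis' )
  qed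
  have "fourier_basis (axis j 1) x = fourier_basis (axis j 1) y"
    using eq by (simp add: torus_point_def vec_eq_iff)
  then have "exp (2 * of_real pi * \<i> * of_real (x $ j)) = exp (2 * of_real pi * \<i> * of_real (y $ j))"
    by (simp add: fourier_basis_def comp)
  then obtain n :: int where "2 * of_real pi * \<i> * complex_of_real (x $ j) =
      2 * of_real pi * \<i> * of_real (y $ j) + of_int (2 * n) * of_real pi * \<i>"
    by (auto simp: exp_eq)
  then have "2 * pi * x $ j = 2 * pi * y $ j + 2 * n * pi"
    by (simp add: complex_eq_iff)
  then have "2 * pi * x $ j = 2 * pi * (y $ j + n)" by (simp add: algebra_simps)
  then have n: "x $ j = y $ j + n" by simp
  have "0 < x $ j" "x $ j < 1" "0 < y $ j" "y $ j < 1"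
    using x y by (auto simp: mem_box_cart)
  with n have "real_of_int n < 1" "real_of_int n > -1" by linarith+
  then have "n = 0" by linarith
  with n show "x $ j = y $ j" by simp
qed

lemma complex_vec_expansion:
  fixes z :: "complex ^ 'n::finite"
  shows "z = (\<Sum>j\<in>UNIV. Re (z $ j) *\<^sub>R axis j 1 + Im (z $ j) *\<^sub>R axis j \<i>)"
proof (subst vec_eq_iff, intro allI)
  fix i
  have "(\<Sum>j\<in>UNIV. Re (z $ j) *\<^sub>R axis j 1 + Im (z $ j) *\<^sub>R axis j \<i>) $ i =
        (\<Sum>j\<in>UNIV. if j = i then z $ j else 0)"
    unfolding sum_component
    by (rule sum.cong) (auto simp: axis_def complex_eq_iff)
  then show "z $ i = (\<Sum>j\<in>UNIV. Re (z $ j) *\<^sub>R axis j 1 + Im (z $ j) *\<^sub>R axis j \<i>) $ i"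
    by simp
qed

text \<open>
  The statement is general in \<open>f\<close>, so that the induction step for a product of polynomials is
  an iteration of the two induction hypotheses. The linear case holds because the real and
  imaginary parts of \<open>exp (2\<pi>i x\<^sub>j)\<close> are combinations of two exponentials.
\<close>

lemma null_coeffs_mult_polynomial:
  fixes f :: "real ^ 'n::finite \<Rightarrow> complex"
  assumes "real_polynomial_function p" "null_coeffs f"
  shows "null_coeffs (\<lambda>x. f x * of_real (p (torus_point x)))"
  using assms
proof (induction p arbitrary: f rule: real_polynomial_function.induct)
  case (linear p)
  then interpret p: bounded_linear p by simp
  define a where "a j = complex_of_real (p (axis j 1)) / 2" for j
  define b where "b j = complex_of_real (p (axis j \<i>)) / (2 * \<i>)" for j
  have "complex_of_real (p (torus_point x)) =
      (\<Sum>j\<in>UNIV. (a j + b j) * fourier_basis (axis j 1) x + (a j - b j) * fourier_basis (- axis j 1) x)"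
    for x
  proof -
    have "p (torus_point x) = (\<Sum>j\<in>UNIV. Re (fourier_basis (axis j 1) x) * p (axis j 1) +
           Im (fourier_basis (axis j 1) x) * p (axis j \<i>))"
      by (subst complex_vec_expansion) (simp add: p.sum p.add p.scale torus_point_def)
    moreover have "complex_of_real (Re w * p (axis j 1) + Im w * p (axis j \<i>)) =
        (a j + b j) * w + (a j - b j) * cnj w" for w j
      by (simp add: a_def b_def complex_eq_iff field_simps)
    ultimately show ?thesis
      by (simp only: of_real_sum cnj_fourier_basis_uminus)
  qed
  then have "(\<lambda>x. f x * of_real (p (torus_point x))) = (\<lambda>x. \<Sum>j\<in>UNIV.
      (a j + b j) * (f x * fourier_basis (axis j 1) x) + (a j - b j) * (f x * fourier_basis (- axis j 1) x))"
    by (simp add: sum_distrib_left algebra_simps)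
  then show ?case
    using linear by (simp add: null_coeffs_sum null_coeffs_add null_coeffs_cmult null_coeffs_mult_basis)
next
  case (const c)
  then show ?case using null_coeffs_cmult[of f "of_real c"] by (simp add: mult.commute)
next
  case (add p q)
  then show ?case by (simp add: distrib_left null_coeffs_add)
next
  case (mult p q)
  from mult.IH(2)[OF mult.IH(1)[OF mult.prems]] show ?case by (simp add: mult.assoc)
qed

lemma null_coeffs_integral:
  assumes "null_coeffs f" shows "(LINT x|cell_measure. f x) = 0"
  using assms unfolding null_coeffs_def by (metis (no_types, lifting) fourier_basis_0 mult_1_right Bochner_Integration.integral_cong)

lemma null_coeffs_integral_continuous:
  fixes f :: "real ^ 'n::finite \<Rightarrow> complex" and g :: "complex ^ 'n \<Rightarrow> real"
  assumes f: "null_coeffs f" and g: "continuous_on UNIV g"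
  shows "(LINT x|cell_measure. f x * of_real (g (torus_point x))) = 0"
proof -
  have intf: "integrable cell_measure f" using f by (simp add: null_coeffs_def)
  let ?T = "torus_point ` cbox 0 (One :: real ^ 'n)"
  have T: "compact ?T"
    by (intro compact_continuous_image continuous_torus_point compact_cbox)
  let ?I = "LINT x|cell_measure. f x * of_real (g (torus_point x))"
  let ?C = "LINT x|cell_measure. norm (f x)"
  have meas: "(\<lambda>x. complex_of_real (h (torus_point x))) \<in> borel_measurable cell_measure"
    if "continuous_on UNIV h" for h :: "complex ^ 'n \<Rightarrow> real"
    by (intro measurable_cell_continuous continuous_intros
        continuous_on_compose2[OF that continuous_torus_point]) auto
  have *: "norm ?I \<le> e * ?C" if "e > 0" for e
  proof -
    obtain p where p: "real_polynomial_function p" "\<And>z. z \<in> ?T \<Longrightarrow> \<bar>g z - p z\<bar> < e"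
      using Stone_Weierstrass_real_polynomial_function[OF T continuous_on_subset[OF g subset_UNIV] \<open>e > 0\<close>]
      by blast
    have contp: "continuous_on UNIV p"
      using p(1) real_polynomial_function_eq continuous_on_polymonial_function by blast
    have intp: "integrable cell_measure (\<lambda>x. f x * of_real (p (torus_point x)))"
      "(LINT x|cell_measure. f x * of_real (p (torus_point x))) = 0"
      using null_coeffs_mult_polynomial[OF p(1) f] null_coeffs_integral by (auto simp: null_coeffs_def)
    let ?d = "\<lambda>x. f x * of_real (g (torus_point x) - p (torus_point x))"
    have d_le: "norm (?d x) \<le> e * norm (f x)" if "x \<in> box 0 One" for x
    proof -
      have "torus_point x \<in> ?T" using that box_subset_cbox by blast
      then have "\<bar>g (torus_point x) - p (torus_point x)\<bar> \<le> e" using p(2) by force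
      then show ?thesis
        unfolding norm_mult norm_of_real by (metis mult.commute mult_right_mono norm_ge_zero)
    qed
    have intd: "integrable cell_measure ?d"
    proof (rule Bochner_Integration.integrable_bound)
      show "integrable cell_measure (\<lambda>x. e * norm (f x))" using intf by simp
      show "?d \<in> borel_measurable cell_measure"
        using intf by (intro borel_measurable_times meas continuous_intros g contp) auto
      show "AE x in cell_measure. norm (?d x) \<le> norm (e * norm (f x))"
        using d_le by (intro AE_I2) (force simp: space_restrict_space)
    qed
    have "?I = (LINT x|cell_measure. ?d x + f x * of_real (p (torus_point x)))"
      by (simp add: algebra_simps)
    also have "\<dots> = (LINT x|cell_measure. ?d x)"
      using intd intp by simp
    finally have "norm ?I \<le> (LINT x|cell_measure. norm (?d x))" by simp
    also have "\<dots> \<le> (LINT x|cell_measure. e * norm (f x))"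
      using intd intf d_le by (intro integral_mono) (auto simp: space_restrict_space)
    finally show ?thesis by simp
  qed
  have "norm ?I \<le> 0"
  proof (rule field_le_epsilon)
    fix e :: real assume "e > 0"
    have C0: "?C \<ge> 0" by simp
    have "norm ?I \<le> e / (1 + ?C) * ?C"
      using \<open>e > 0\<close> C0 by (intro *) (simp add: add_pos_nonneg)
    also have "\<dots> \<le> e" using \<open>e > 0\<close> C0 by (simp add: field_simps add_pos_nonneg)
    finally show "norm ?I \<le> 0 + e" by simp
  qed
  then show ?thesis by simp
qed

lemma null_coeffs_integral_compact:
  fixes f :: "real ^ 'n::finite \<Rightarrow> complex"
  assumes f: "null_coeffs f" and K: "compact K" "K \<subseteq> box 0 One"
  shows "(LINT x|cell_measure. f x * of_real (indicator K x)) = 0"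
proof (cases "K = {}")
  case False
  have intf: "integrable cell_measure f" using f by (simp add: null_coeffs_def)
  let ?T = "torus_point ` K"
  have T: "closed ?T" "?T \<noteq> {}"
    using K False by (auto intro!: compact_imp_closed compact_continuous_image continuous_torus_point)
  \<comment> \<open>Continuous functions decreasing to the indicator function of the image of \<open>K\<close>. No point of
      the open cell outside \<open>K\<close> is mapped into that image, as the embedding is injective there.\<close>
  define g where "g m z = max 0 (1 - real m * infdist z ?T)" for m z
  have contg: "continuous_on UNIV (g m)" for m
    unfolding g_def by (intro continuous_intros)
  have g01: "0 \<le> g m z" "g m z \<le> 1" for m z
    by (auto simp: g_def infdist_nonneg)
  have contgt: "continuous_on UNIV (\<lambda>x. complex_of_real (g m (torus_point x)))" for m
    by (intro continuous_intros continuous_on_compose2[OF contg continuous_torus_point]) auto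
  have "(\<lambda>m. LINT x|cell_measure. f x * of_real (g m (torus_point x))) \<longlonglongrightarrow>
        (LINT x|cell_measure. f x * of_real (indicator K x))"
  proof (rule integral_dominated_convergence[where w = "\<lambda>x. norm (f x)"])
    show "(\<lambda>x. f x * of_real (g m (torus_point x))) \<in> borel_measurable cell_measure" for m
      using intf by (intro borel_measurable_times measurable_cell_continuous[OF contgt]) auto
    have "K \<in> sets lebesgue" by (rule compact_imp_sets_lebesgue[OF K(1)])
    then have "(\<lambda>x. of_real (indicator K x) :: complex) \<in> borel_measurable cell_measure"
      by (intro measurable_restrict_space1) simp
    then show "(\<lambda>x. f x * of_real (indicator K x)) \<in> borel_measurable cell_measure"
      using intf by (intro borel_measurable_times) auto
    show "integrable cell_measure (\<lambda>x. norm (f x))" using intf by simp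
    show "AE x in cell_measure. norm (f x * of_real (g m (torus_point x))) \<le> norm (f x)" for m
      using g01 by (simp add: norm_mult mult_left_le)
    show "AE x in cell_measure. (\<lambda>m. f x * of_real (g m (torus_point x))) \<longlonglongrightarrow> f x * of_real (indicator K x)"
    proof (rule AE_I2)
      fix x :: "real ^ 'n" assume "x \<in> space cell_measure"
      then have x: "x \<in> box 0 One" by (simp add: space_restrict_space)
      have "(\<lambda>m. g m (torus_point x)) \<longlonglongrightarrow> indicator K x"
      proof (cases "x \<in> K")
        case True
        then have "g m (torus_point x) = 1" for m by (simp add: g_def)
        then show ?thesis using True by simp
      next
        case False
        have "torus_point x \<notin> ?T"
        proof
          assume "torus_point x \<in> ?T"
          then obtain y where "y \<in> K" "torus_point x = torus_point y" by blast
          with torus_point_inj[of x y] x K False show False by auto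
        qed
        then have pos: "infdist (torus_point x) ?T > 0"
          using T infdist_pos_not_in_closed by blast
        obtain N where N: "1 < real N * infdist (torus_point x) ?T"
          using reals_Archimedean3[OF pos] by blast
        have "g m (torus_point x) = 0" if "m \<ge> N" for m
        proof -
          have "real N * infdist (torus_point x) ?T \<le> real m * infdist (torus_point x) ?T"
            using that pos by (intro mult_right_mono) auto
          with N show ?thesis by (simp add: g_def)
        qed
        then have "eventually (\<lambda>m. g m (torus_point x) = 0) sequentially"
          by (auto simp: eventually_sequentially)
        then show ?thesis using False by (simp add: tendsto_eventually)
      qed
      then show "(\<lambda>m. f x * of_real (g m (torus_point x))) \<longlonglongrightarrow> f x * of_real (indicator K x)"
        by (intro tendsto_mult tendsto_const tendsto_of_real)
    qed
  qed
  moreover have "(LINT x|cell_measure. f x * of_real (g m (torus_point x))) = 0" for m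
    by (rule null_coeffs_integral_continuous[OF f contg])
  ultimately show ?thesis by (simp add: LIMSEQ_const_iff)
qed simp

lemma negligible_positive_part:
  fixes g :: "real ^ 'n::finite \<Rightarrow> real"
  assumes g: "integrable cell_measure g"
    and K: "\<And>K. compact K \<Longrightarrow> K \<subseteq> box 0 One \<Longrightarrow> (LINT x|cell_measure. g x * indicator K x) = 0"
  shows "negligible {x \<in> box 0 One. g x > 0}"
proof -
  let ?S = "{x \<in> box 0 One. g x > 0}"
  have [measurable]: "g \<in> borel_measurable cell_measure" using g by auto
  have "{x \<in> space cell_measure. g x > 0} \<in> sets cell_measure" by measurable
  then have S: "?S \<in> sets lebesgue"
    by (simp add: space_restrict_space sets_restrict_space_iff)
  obtain C T where C: "fsigma C" "T \<in> null_sets lebesgue" "C \<union> T = ?S"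
    by (rule lebesgue_set_almost_fsigma[OF S])
  obtain F :: "nat \<Rightarrow> (real ^ 'n) set" where "range F \<subseteq> Collect compact" and FC: "C = (\<Union>i. F i)"
    using C(1) unfolding fsigma_Union_compact by blast
  then have F: "compact (F i)" for i by blast
  have "negligible (F i)" for i
  proof -
    have sub: "F i \<subseteq> ?S" using C FC by blast
    have Fs: "F i \<in> sets lebesgue" by (rule compact_imp_sets_lebesgue[OF F])
    have "integrable cell_measure (\<lambda>x. g x * indicator (F i) x)"
    proof (rule integrable_real_mult_indicator[OF _ g])
      show "F i \<in> sets cell_measure" using Fs sub by (auto simp: sets_restrict_space_iff)
    qed
    moreover have "AE x in cell_measure. 0 \<le> g x * indicator (F i) x"
      using sub by (intro AE_I2) (auto simp: indicator_def intro: less_imp_le)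
    moreover have "(LINT x|cell_measure. g x * indicator (F i) x) = 0"
      using sub by (intro K F) auto
    ultimately have "AE x in cell_measure. g x * indicator (F i) x = 0"
      using integral_nonneg_eq_0_iff_AE by blast
    then have "AE x in lebesgue. x \<in> box 0 One \<longrightarrow> g x * indicator (F i) x = 0"
      by (simp add: AE_restrict_space_iff)
    then have "AE x in lebesgue. x \<notin> F i"
      by eventually_elim (use sub in \<open>auto simp: indicator_def\<close>)
    then show ?thesis
      by (simp add: completion.AE_iff_null_sets negligible_iff_null_sets)
  qed
  then have "negligible C" unfolding FC by (rule negligible_Union_nat)
  then show ?thesis
    using C by (metis negligible_Un negligible_iff_null_sets)
qed

text \<open>
  A nonzero complex number \<open>z\<close> has a positive real part after multiplication by one of
  \<open>1, -1, \<i>, -\<i>\<close>, and these multiples of \<open>f\<close> have vanishing coefficients as well.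
\<close>

lemma null_coeffs_negligible:
  fixes f :: "real ^ 'n::finite \<Rightarrow> complex"
  assumes f: "null_coeffs f"
  shows "negligible {x \<in> box 0 One. f x \<noteq> 0}"
proof -
  have intf: "integrable cell_measure f" using f by (simp add: null_coeffs_def)
  have neg: "negligible {x \<in> box 0 One. Re (c * f x) > 0}" for c
  proof (rule negligible_positive_part)
    have cf: "null_coeffs (\<lambda>x. c * f x)" by (rule null_coeffs_cmult[OF f])
    then have int: "integrable cell_measure (\<lambda>x. c * f x)" by (simp add: null_coeffs_def)
    then show "integrable cell_measure (\<lambda>x. Re (c * f x))" by (rule integrable_Re)
    fix K :: "(real ^ 'n) set" assume K: "compact K" "K \<subseteq> box 0 One"
    have "K \<in> sets cell_measure"
      using K by (simp add: sets_restrict_space_iff compact_imp_sets_lebesgue)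
    then have "integrable cell_measure (\<lambda>x. indicator K x *\<^sub>R (c * f x))"
      using int by (rule integrable_mult_indicator)
    then have "integrable cell_measure (\<lambda>x. c * f x * of_real (indicator K x))"
      by (simp add: scaleR_conv_of_real mult_ac)
    then have "(LINT x|cell_measure. Re (c * f x * of_real (indicator K x))) =
       Re (LINT x|cell_measure. c * f x * of_real (indicator K x))"
      by (rule integral_Re)
    then show "(LINT x|cell_measure. Re (c * f x) * indicator K x) = 0"
      using null_coeffs_integral_compact[OF cf K] by simp
  qed
  have "{x \<in> box 0 One. f x \<noteq> 0} \<subseteq>
      {x \<in> box 0 One. Re (1 * f x) > 0} \<union> {x \<in> box 0 One. Re (-1 * f x) > 0} \<union>
      {x \<in> box 0 One. Re (\<i> * f x) > 0} \<union> {x \<in> box 0 One. Re (-\<i> * f x) > 0}"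
    by (auto simp: complex_eq_iff)
  then show ?thesis
    by (rule negligible_subset[rotated]) (intro negligible_Un neg)
qed

text \<open>The integer translates of the open cell cover the space up to a null set.\<close>

lemma periodic_AE_zero:
  fixes f :: "real ^ 'n::finite \<Rightarrow> complex"
  assumes per: "\<And>m x. f (x + lattice_vec m) = f x"
    and neg: "negligible {x \<in> box 0 One. f x \<noteq> 0}"
  shows "AE x in lebesgue. f x = 0"
proof -
  let ?N = "{x \<in> box 0 One. f x \<noteq> 0} \<union> (cbox 0 One - box 0 One)"
  have "negligible ?N" by (intro negligible_Un neg negligible_frontier_interval)
  then have "negligible (\<Union>(range (\<lambda>m. (+) (lattice_vec m) ` ?N)))"
    by (intro negligible_countable_Union) (auto intro: negligible_translation)
  moreover have "{x. f x \<noteq> 0} \<subseteq> \<Union>(range (\<lambda>m. (+) (lattice_vec m) ` ?N))"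
  proof
    fix x assume x: "x \<in> {x. f x \<noteq> 0}"
    define m :: "int ^ 'n" where "m = (\<chi> i. \<lfloor>x $ i\<rfloor>)"
    define y where "y = x - lattice_vec m"
    have "f y = f x" using per[of y m] by (simp add: y_def)
    moreover have "y \<in> cbox 0 One"
    proof -
      have "0 \<le> t - of_int \<lfloor>t\<rfloor>" "t - of_int \<lfloor>t\<rfloor> \<le> 1" for t :: real by linarith+
      then show ?thesis by (simp add: mem_box_cart y_def m_def lattice_vec_def)
    qed
    ultimately have "y \<in> ?N" using x by auto
    moreover have "x = lattice_vec m + y" by (simp add: y_def)
    ultimately show "x \<in> \<Union>(range (\<lambda>m. (+) (lattice_vec m) ` ?N))" by blast
  qed
  ultimately have "negligible {x. f x \<noteq> 0}" by (rule negligible_subset)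
  then show ?thesis
    by (simp add: completion.AE_iff_null_sets negligible_iff_null_sets)
qed

section \<open>Fourier coefficients of classes of integrable functions\<close>

lemma torus_L1_representative:
  obtains f where "torus_integrable f" "u = abs_torus_L1 f"
proof -
  have "\<exists>f. torus_integrable f \<and> u = abs_torus_L1 f"
    by (induction u rule: torus_L1.abs_induct) (auto simp: torus_ae_eq_def)
  then show thesis using that by blast
qed

lemma fourier_coeff_abs:
  assumes "torus_integrable f"
  shows "fourier_coeff (abs_torus_L1 f) k = (LINT x|cell_measure. f x * cnj (fourier_basis k x))"
  using assms by (simp add: fourier_coeff.abs_eq torus_ae_eq_def set_integral_cell_eq)

lemma fourier_coeff_torus_basis:
  "fourier_coeff (torus_basis k) l = (if k = l then 1 else 0)"
  by (simp add: torus_basis.abs_eq fourier_coeff_abs torus_integrable_fourier_basis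
      fourier_basis_orthonormal)

lemma integrable_cell_coeff_integrand:
  assumes "torus_integrable f"
  shows "integrable cell_measure (\<lambda>x. f x * cnj (fourier_basis k x))"
  using assms unfolding torus_integrable_def set_integrable_cell_iff cnj_fourier_basis_uminus
  by (blast intro: integrable_cell_mult_fourier_basis)

lemma fourier_coeff_0 [simp]: "fourier_coeff 0 k = 0"
  by (simp add: zero_torus_L1.abs_eq fourier_coeff_abs torus_integrable_zero)

lemma fourier_coeff_add: "fourier_coeff (u + v) k = fourier_coeff u k + fourier_coeff v k"
proof -
  obtain f g where f: "torus_integrable f" "u = abs_torus_L1 f"
    and g: "torus_integrable g" "v = abs_torus_L1 g"
    by (metis torus_L1_representative)
  then have "u + v = abs_torus_L1 (\<lambda>x. f x + g x)"
    by (simp add: plus_torus_L1.abs_eq torus_ae_eq_def)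
  then show ?thesis
    using f g by (simp add: fourier_coeff_abs torus_integrable_add distrib_right
        integrable_cell_coeff_integrand)
qed

lemma fourier_coeff_diff: "fourier_coeff (u - v) k = fourier_coeff u k - fourier_coeff v k"
  using fourier_coeff_add[of "u - v" v k] by simp

lemma fourier_coeff_scale: "fourier_coeff (torus_scale c u) k = c * fourier_coeff u k"
proof -
  obtain f where f: "torus_integrable f" "u = abs_torus_L1 f"
    by (rule torus_L1_representative)
  then have "torus_scale c u = abs_torus_L1 (\<lambda>x. c * f x)"
    by (simp add: torus_scale.abs_eq torus_ae_eq_def)
  then show ?thesis
    using f by (simp add: fourier_coeff_abs torus_integrable_mult mult.assoc)
qed

lemma fourier_coeff_sum: "fourier_coeff (\<Sum>i\<in>I. u i) k = (\<Sum>i\<in>I. fourier_coeff (u i) k)"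
  by (induction I rule: infinite_finite_induct) (simp_all add: fourier_coeff_add)

lemma fourier_coeff_trig_sum:
  assumes "finite F"
  shows "fourier_coeff (\<Sum>k\<in>F. torus_scale (c k) (torus_basis k)) l = (if l \<in> F then c l else 0)"
  using assms
  by (simp add: fourier_coeff_sum fourier_coeff_scale fourier_coeff_torus_basis
      if_distrib[of "\<lambda>y. _ * y"] cong: if_cong)

theorem fourier_coeff_eqI:
  assumes "\<And>k. fourier_coeff u k = fourier_coeff v k"
  shows "u = v"
proof -
  obtain f where f: "torus_integrable f" "u - v = abs_torus_L1 f"
    by (rule torus_L1_representative)
  have "(LINT x|cell_measure. f x * cnj (fourier_basis (- k) x)) = 0" for k
    using fourier_coeff_abs[OF f(1), of "- k"] fourier_coeff_diff[of u v "- k"] assms f(2) by simp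
  then have "null_coeffs f"
    using f(1) by (simp add: null_coeffs_def torus_integrable_def set_integrable_cell_iff
        cnj_fourier_basis_uminus)
  then have "AE x in lebesgue. f x = 0"
    using f(1) by (intro periodic_AE_zero null_coeffs_negligible) (auto simp: torus_integrable_def)
  then have "torus_ae_eq f (\<lambda>_. 0)"
    using f(1) by (simp add: torus_ae_eq_def torus_integrable_zero)
  then have "u - v = 0"
    unfolding f(2) zero_torus_L1_def by (rule Quotient_rel_abs[OF Quotient_torus_L1])
  then show ?thesis by simp
qed

theorem riesz_fischer:
  assumes "(\<lambda>k. (norm (c k))\<^sup>2) summable_on UNIV"
  obtains w where "\<And>k. fourier_coeff w k = c k"
proof -
  obtain W where "torus_integrable W"
    "\<And>k. (LINT x|cell_measure. W x * cnj (fourier_basis k x)) = c k"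
    using riesz_fischer_function[OF assms] by blast
  then show thesis by (intro that[of "abs_torus_L1 W"]) (simp add: fourier_coeff_abs)
qed

section \<open>The adjoint of the Sobolev embedding\<close>

lemma sobolev_weight_ge_1: "1 \<le> sobolev_weight k"
  by (simp add: sobolev_weight_def)

lemma sobolev_inner_torus_basis:
  "sobolev_inner s u (torus_basis k) = of_real (sobolev_weight k powr s) * fourier_coeff u k"
proof -
  have "sobolev_inner s u (torus_basis k) =
      (\<Sum>\<^sub>\<infinity>l\<in>{k}. of_real (sobolev_weight l powr s) * fourier_coeff u l * cnj (fourier_coeff (torus_basis k) l))"
    unfolding sobolev_inner_def
    by (rule infsum_cong_neutral) (auto simp: fourier_coeff_torus_basis)
  then show ?thesis by (simp add: fourier_coeff_torus_basis)
qed

lemma torus_basis_in_sobolev_space: "torus_basis k \<in> sobolev_space s"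
proof -
  have "(\<lambda>l. sobolev_weight l powr s * (cmod (fourier_coeff (torus_basis k) l))\<^sup>2) summable_on {k}"
    by simp
  then have "(\<lambda>l. sobolev_weight l powr s * (cmod (fourier_coeff (torus_basis k) l))\<^sup>2) summable_on UNIV"
    by (rule summable_on_cong_neutral[THEN iffD1, rotated -1]) (auto simp: fourier_coeff_torus_basis)
  then show ?thesis by (simp add: sobolev_space_def)
qed

lemma sobolev_weighted_square_le:
  assumes "0 \<le> s"
  shows "sobolev_weight k powr s * (cmod (of_real (sobolev_weight k powr (- s)) * z))\<^sup>2 \<le> (cmod z)\<^sup>2"
    and "(cmod (of_real (sobolev_weight k powr (- s)) * z))\<^sup>2 \<le> (cmod z)\<^sup>2"
proof -
  let ?w = "sobolev_weight k"
  have w: "?w > 0" using sobolev_weight_ge_1[of k] by linarith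
  have le1: "?w powr (- s) \<le> 1"
    using powr_mono[of "- s" 0 ?w] sobolev_weight_ge_1[of k] assms w by simp
  have "?w powr s * (?w powr (- s))\<^sup>2 = ?w powr (- s)"
    using w by (simp add: power2_eq_square flip: powr_add)
  then have "?w powr s * (cmod (of_real (?w powr (- s)) * z))\<^sup>2 = ?w powr (- s) * (cmod z)\<^sup>2"
    by (simp add: norm_mult power_mult_distrib flip: mult.assoc)
  also have "\<dots> \<le> (cmod z)\<^sup>2" using le1 by (simp add: mult_left_le_one_le)
  finally show "?w powr s * (cmod (of_real (?w powr (- s)) * z))\<^sup>2 \<le> (cmod z)\<^sup>2" .
  have "(?w powr (- s))\<^sup>2 \<le> 1" using le1 by (simp add: power_le_one)
  then show "(cmod (of_real (?w powr (- s)) * z))\<^sup>2 \<le> (cmod z)\<^sup>2"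
    by (simp add: norm_mult power_mult_distrib mult_left_le_one_le)
qed

lemma sobolev_embedding_adjoint_coeff:
  assumes s: "0 \<le> s" and u: "u \<in> torus_L2"
  shows "sobolev_embedding_adjoint s u \<in> sobolev_space s"
    and "fourier_coeff (sobolev_embedding_adjoint s u) k =
         of_real (sobolev_weight k powr (- s)) * fourier_coeff u k"
proof -
  define c where "c k = of_real (sobolev_weight k powr (- s)) * fourier_coeff u k" for k
  have w: "sobolev_weight k > 0" for k :: "int ^ 'a" using sobolev_weight_ge_1[of k] by linarith
  have u2: "(\<lambda>k. (cmod (fourier_coeff u k))\<^sup>2) summable_on UNIV"
    using u w by (simp add: sobolev_space_def less_imp_neq[symmetric])
  have "(\<lambda>k. (cmod (c k))\<^sup>2) summable_on UNIV"
    unfolding c_def by (rule summable_on_comparison_test[OF u2])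
      (use sobolev_weighted_square_le(2)[OF s] in auto)
  then obtain w0 where w0: "\<And>k. fourier_coeff w0 k = c k"
    using riesz_fischer by blast
  have w0s: "w0 \<in> sobolev_space s"
    unfolding sobolev_space_def w0 c_def mem_Collect_eq
    by (rule summable_on_comparison_test[OF u2])
       (use sobolev_weighted_square_le(1)[OF s] in auto)
  \<comment> \<open>The two inner products agree term by term.\<close>
  have ww: "complex_of_real (sobolev_weight k powr s) * c k =
      of_real (sobolev_weight k powr 0) * fourier_coeff u k" for k
    using w[of k] by (simp add: c_def flip: mult.assoc of_real_mult powr_add)
  have "sobolev_embedding_adjoint s u = w0"
    unfolding sobolev_embedding_adjoint_def sobolev_embedding_def
  proof (rule the_equality)
    show "w0 \<in> sobolev_space s \<and> (\<forall>v\<in>sobolev_space s. sobolev_inner s w0 v = torus_L2_inner u v)"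
      using w0s by (simp add: sobolev_inner_def w0 ww)
    fix w' assume w': "w' \<in> sobolev_space s \<and>
        (\<forall>v\<in>sobolev_space s. sobolev_inner s w' v = torus_L2_inner u v)"
    show "w' = w0"
    proof (rule fourier_coeff_eqI)
      fix k
      have "sobolev_inner s w' (torus_basis k) = torus_L2_inner u (torus_basis k)"
        using w' torus_basis_in_sobolev_space by blast
      then have "of_real (sobolev_weight k powr s) * fourier_coeff w' k =
          of_real (sobolev_weight k powr s) * c k"
        by (simp only: sobolev_inner_torus_basis ww)
      then show "fourier_coeff w' k = fourier_coeff w0 k"
        using w[of k] by (simp add: w0)
    qed
  qed
  then show "sobolev_embedding_adjoint s u \<in> sobolev_space s"
    "fourier_coeff (sobolev_embedding_adjoint s u) k =
         of_real (sobolev_weight k powr (- s)) * fourier_coeff u k"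
    using w0s w0 by (simp_all add: c_def)
qed

text \<open>The Fourier series of an element of \<open>H\<^sup>s\<close> converges to it in \<open>H\<^sup>s\<close>.\<close>

lemma sobolev_norm_partial_sum_tendsto:
  assumes v: "v \<in> sobolev_space s"
  shows "((\<lambda>F. sobolev_norm s (v - (\<Sum>k\<in>F. torus_scale (fourier_coeff v k) (torus_basis k))))
           \<longlongrightarrow> 0) (finite_subsets_at_top UNIV)"
proof -
  let ?h = "\<lambda>k. sobolev_weight k powr s * (cmod (fourier_coeff v k))\<^sup>2"
  have h: "?h summable_on UNIV" using v by (simp add: sobolev_space_def)
  have eq: "sobolev_norm s (v - (\<Sum>k\<in>F. torus_scale (fourier_coeff v k) (torus_basis k))) =
      sqrt (infsum ?h UNIV - sum ?h F)" if F: "finite F" for F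
  proof -
    have "(\<Sum>\<^sub>\<infinity>k. sobolev_weight k powr s *
        (cmod (fourier_coeff (v - (\<Sum>k\<in>F. torus_scale (fourier_coeff v k) (torus_basis k))) k))\<^sup>2) =
        infsum ?h (UNIV - F)"
      by (rule infsum_cong_neutral) (auto simp: fourier_coeff_diff fourier_coeff_trig_sum[OF F])
    also have "\<dots> = infsum ?h UNIV - infsum ?h F"
      by (rule infsum_Diff[OF h]) (use F in auto)
    finally show ?thesis using F by (simp add: sobolev_norm_def)
  qed
  have "((\<lambda>F. sqrt (infsum ?h UNIV - sum ?h F)) \<longlongrightarrow> sqrt (infsum ?h UNIV - infsum ?h UNIV))
      (finite_subsets_at_top UNIV)"
    by (intro tendsto_intros infsum_tendsto h)
  then have "((\<lambda>F. sqrt (infsum ?h UNIV - sum ?h F)) \<longlongrightarrow> 0) (finite_subsets_at_top UNIV)"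
    by simp
  then show ?thesis
    by (rule Lim_transform_eventually)
       (rule eventually_finite_subsets_at_top_weakI, simp add: eq)
qed

theorem proposition7p3:
  fixes s :: real and u :: "'n::finite torus_L1"
  assumes "0 \<le> s" and "u \<in> torus_L2"
  shows "sobolev_embedding_adjoint s u \<in> sobolev_space s \<and>
         ((\<lambda>F. sobolev_norm s
              (sobolev_embedding_adjoint s u -
               (\<Sum>k\<in>F. torus_scale (of_real (sobolev_weight k powr (- s)) * fourier_coeff u k)
                          (torus_basis k))))
           \<longlongrightarrow> 0) (finite_subsets_at_top UNIV)"
  using sobolev_norm_partial_sum_tendsto[OF sobolev_embedding_adjoint_coeff(1)[OF assms]]
  by (simp add: sobolev_embedding_adjoint_coeff[OF assms])

end
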